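(* The Cordial Dissemination protocol $\mathcal{C}\mathcal{D}$ is grassroots; that is, writing $CD(P)$ for its member over $P$, $\emptyset\subset P\subset P'\subseteq\Pi$ implies $CD(P)\subset CD(P')/P$.
   Context: $\Pi$ is a (possibly infinite) set of agents, each identified with a public key; sets of agents $P,P'\subseteq\Pi$ referred to below are finite; $\subset$ denotes strict inclusion. **Transition systems and protocols.** A local states function $S$ maps each $P\subseteq\Pi$ to a set $S(P)$ of local states, with $S(\emptyset)=\{s0\}$, $P\subset P'\implies S(P)\subset S(P')$, and a partial order on $S(\Pi)$ with unique least element $s0$. A configuration over $P$ and $X\subseteq S(\Pi)$ is an element $c\in C:=X^P$, with $c_p$ the local state of $p$, and $c0:=\{s0\}^P$ the initial configuration. A transition is a pair $c\rightarrow c'\in C^2$; it is a $p$-transition if $c_p\neq c'_p$ and $c_q=c'_q$ for all $q\ne p$. A distributed multiagent transition system $(P,X,T,\lambda)$ has correct transitions $T=\bigcup_{p\in P}T_p$, $T_p$ a set of $p$-transitions, and a liveness requirement $\lambda\subset 2^T$. A protocol over $S$ is a family with exactly one transition system $TS(P)=(P,S(P),T(P),\lambda(P))$ for every $\emptyset\subset P\subseteq\Pi$. **Projection.** For $\emptyset\subset P\subset P'\subseteq\Pi$ and $c'$ over $P'$ and $S(P')$, $c'/P$ is the configuration over $P$ (local states in $S(P')$) with $(c'/P)_p=c'_p$. For $TS(P')=(P',S(P'),T',\lambda')$, $TS(P')/P:=(P,S(P'),T'/P,\lambda'/P)$ with $T'/P=\{c_1/P\rightarrow c_2/P:c_1\rightarrow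 c_2\in T'\}$ and $\lambda'/P=\{L/P:L\in\lambda'\}$, $L/P$ defined likewise. **Subset, grassroots.** $(P,X,T,\lambda)\subseteq(P,X',T',\lambda')$ if $X\subseteq X'$, $T\subseteq T'$ and $\lambda=\{L\cap T:L\in\lambda'\}$; $\subset$ is the strict version ($\subseteq$ and not equal). A protocol is grassroots if $\emptyset\subset P\subset P'\subseteq\Pi$ implies $TS(P)\subset TS(P')/P$. **Blocks and blocklaces.** A payloads function $\mathcal{X}$ maps each $P$ to a set of payloads $\mathcal{X}(P)$ (monotone in $P$), including $(\textit{follow},q)$ for $q\in P$. $\mathit{hash}$ is a cryptographic hash function, treated as collision-free. A block over $P$ is a triple $b=(h^p,H,x)$, called a $p$-block (with creator $p\in P$), where $h^p$ (a $p$-pointer) is $\mathit{hash}((H,x))$ signed by $p$, $x\in\mathcal{X}(P)$ is the payload, and $H$ is a finite set of signed hash pointers, such that for each $h^q\in H$ there is a $q$-block $b'=(h^q,H',x')$ over $P$; then $b$ points to $b'$, and $h^q$ is a self-pointer if $q=p$. $b$ is initial if $H=\emptyset$. $\mathcal{B}(P)$ is the set of all blocks over $P$ (generated recursively from initial blocks; pointers form no cycles). A blocklace over $P$ is a subset $B\subseteq\mathcal{B}(P)$, viewed as a directed graph with an edge from $b$ to $b'$ when $b$ points to $b'$. $b'$ observes $b$ if there is a (possibly empty) path from $b'$ to $b$ in $\mathcal{B}(P)$. **Closure.** For a blocklace $B$ and block $b\in\mathcal{B}(P)$, $[b]$ is the set of blocks reachable from $b$ in $B$ via a (possibly empty) path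 with at most one non-self pointer. $b$ is self-closed in $B$ if the maximal path of self-pointers from $b$ in $B$ ends in an initial block, and closed in $B$ if every block in $[b]$ is self-closed. A $p$-block closed in $B$ is maximally-closed in $B$ if it observes every self-closed $q$-block in $B$ for every $q\in P$ followed by $p$ in $B$ (i.e. for which $B$ has a $p$-block with payload $(\textit{follow},q)$). **Local states.** $\mathit{MSB}(P)$ is the set of pairs $(B,Out)$ with $B$ a finite subset of $\mathcal{B}(P)$ and $Out$ a finite set of messages $(q,b)$, $q\in P$ (destination), $b\in\mathcal{B}(P)$; the order is componentwise inclusion, and the initial local state is $(\emptyset,\emptyset)$. For $c_p=(B_p,Out_p)$, write $b\in c_p$ for $b\in B_p$. **Knowledge.** In a configuration $c$: $p$ knows that $q$ knows $b$ if $c_p$ has a $q$-block that observes $b$; $p$ knows that $q$ follows $p'$ if $c_p$ has a $q$-block that observes a $p'$-block; $p$ knows that $p'$ and $q$ are friends if $p$ knows that $p'$ follows $q$ and that $q$ follows $p'$ ($p=p'$ being a special case, "$p$ knows that $q$ is a friend"). **Cordial Dissemination.** The protocol $\mathcal{C}\mathcal{D}$ has for each $P$ the transition system $CD(P)=(P,\mathit{MSB}(P),T,\lambda)$ with $T$ being all $p$-transitions $c\rightarrow c'$, $p\in P$, with $c_p=(B,Out)$ and one of: 1. Create&Disclose: $c'_p=(B\cup\{b\},Out)$, where $b\in\mathcal{B}(P)\setminus B$ is a $p$-block maximally-closed in $B$; 2. Send-$b$-to-$q$: $c'_p=(B,Out\cup\{(q,b)\})$, $b\in B$; 3. Receive-$b$: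 $c'_p=(B\cup\{b\},Out)$, $b\notin B$, and for some $q\in P$ with $c_q=(B_q,Out_q)$, $(p,b)\in Out_q$; 4. Cordially-Send-$b$-to-$q$: $c'_p=(B,Out\cup\{(q,b)\})$, $b\in B$, $(q,b)\notin Out$, and $p$ knows that $q$ is a friend, $p$ knows that $q$ follows the creator of $b$, and $p$ does not know that $q$ knows $b$. $\lambda$ partitions, for each $p$, the Create&Disclose, Cordially-Send and Receive $p$-transitions according to their labels (all $p$-transitions with the same label Create&Disclose, Cordially-Send-$b$-to-$q$, or Receive-$b$ form one set).
   Formalization: In λ, a p-transition that is both Create&Disclose and Receive-b is labelled only Create&Disclose, and labels carried by no transition contribute the empty set; with overlapping label sets the claim fails when an agent outside P addresses p's own new block to p. *)

theory Defs
  imports "HOL-Library.FuncSet"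
begin

section \<open>Distributed multiagent transition systems\<close>

text \<open>
  The set of all agents is the universe of the type \<open>'a\<close>, which may be infinite.  A configuration
  over \<open>P\<close> and \<open>X\<close> is an element of \<open>P \<rightarrow>\<^sub>E X\<close>, i.e. a function that is \<open>undefined\<close> outside \<open>P\<close>, so
  that equality of configurations is equality on \<open>P\<close>.
\<close>

type_synonym ('a, 's) config = "'a \<Rightarrow> 's"
type_synonym ('a, 's) transition = "('a, 's) config \<times> ('a, 's) config"

record ('a, 's) transition_system =
  agents :: "'a set"
  states :: "'s set"
  correct :: "('a, 's) transition set"
  live :: "('a, 's) transition set set"

definition p_transition ::
  "'a set \<Rightarrow> 's set \<Rightarrow> 'a \<Rightarrow> ('a, 's) config \<Rightarrow> ('a, 's) config \<Rightarrow> bool" where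
  "p_transition P X p c c' \<longleftrightarrow>
     c \<in> P \<rightarrow>\<^sub>E X \<and> c' \<in> P \<rightarrow>\<^sub>E X \<and> p \<in> P \<and> c p \<noteq> c' p \<and> (\<forall>q\<in>P. q \<noteq> p \<longrightarrow> c q = c' q)"

definition distributed_ts :: "('a, 's) transition_system \<Rightarrow> bool" where
  "distributed_ts M \<longleftrightarrow>
     (\<exists>T. (\<forall>p\<in>agents M. T p \<subseteq> {(c, c'). p_transition (agents M) (states M) p c c'}) \<and>
          correct M = (\<Union>p\<in>agents M. T p)) \<and>
     live M \<subset> Pow (correct M)"

definition local_states_fun :: "('a set \<Rightarrow> 's set) \<Rightarrow> 's \<Rightarrow> 's rel \<Rightarrow> bool" where
  "local_states_fun S s0 r \<longleftrightarrow>
     S {} = {s0} \<and> (\<forall>P P'. P \<subset> P' \<longrightarrow> S P \<subset> S P') \<and>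
     partial_order_on (S UNIV) r \<and> (\<forall>s\<in>S UNIV. (s0, s) \<in> r)"

definition protocol ::
  "('a set \<Rightarrow> 's set) \<Rightarrow> ('a set \<Rightarrow> ('a, 's) transition_system) \<Rightarrow> bool" where
  "protocol S TS \<longleftrightarrow>
     (\<forall>P. finite P \<and> P \<noteq> {} \<longrightarrow>
        agents (TS P) = P \<and> states (TS P) = S P \<and> distributed_ts (TS P))"

definition proj_transitions ::
  "('a, 's) transition set \<Rightarrow> 'a set \<Rightarrow> ('a, 's) transition set" where
  "proj_transitions T P = {(restrict c1 P, restrict c2 P) | c1 c2. (c1, c2) \<in> T}"

definition proj_ts ::
  "('a, 's) transition_system \<Rightarrow> 'a set \<Rightarrow> ('a, 's) transition_system" where
  "proj_ts M P =
     \<lparr>agents = P, states = states M, correct = proj_transitions (correct M) P,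
      live = {proj_transitions L P | L. L \<in> live M}\<rparr>"

definition ts_subset ::
  "('a, 's) transition_system \<Rightarrow> ('a, 's) transition_system \<Rightarrow> bool" where
  "ts_subset M N \<longleftrightarrow>
     agents M = agents N \<and> states M \<subseteq> states N \<and> correct M \<subseteq> correct N \<and>
     live M = {L \<inter> correct M | L. L \<in> live N}"

definition ts_psubset ::
  "('a, 's) transition_system \<Rightarrow> ('a, 's) transition_system \<Rightarrow> bool" where
  "ts_psubset M N \<longleftrightarrow> ts_subset M N \<and> M \<noteq> N"

definition grassroots :: "('a set \<Rightarrow> ('a, 's) transition_system) \<Rightarrow> bool" where
  "grassroots TS \<longleftrightarrow>
     (\<forall>P P'. finite P' \<and> {} \<subset> P \<and> P \<subset> P' \<longrightarrow> ts_psubset (TS P) (proj_ts (TS P') P))"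


section \<open>Blocks and blocklaces\<close>

datatype ('a, 'h) pointer = Signed (signer: 'a) (hash_value: 'h)

datatype ('a, 'v) payload = Follow 'a | Content 'v

type_synonym ('a, 'h, 'v) block =
  "('a, 'h) pointer \<times> ('a, 'h) pointer set \<times> ('a, 'v) payload"

abbreviation pointer_of :: "('a, 'h, 'v) block \<Rightarrow> ('a, 'h) pointer" where
  "pointer_of b \<equiv> fst b"

abbreviation pointers :: "('a, 'h, 'v) block \<Rightarrow> ('a, 'h) pointer set" where
  "pointers b \<equiv> fst (snd b)"

abbreviation payload_of :: "('a, 'h, 'v) block \<Rightarrow> ('a, 'v) payload" where
  "payload_of b \<equiv> snd (snd b)"

definition creator :: "('a, 'h, 'v) block \<Rightarrow> 'a" where
  "creator b = signer (pointer_of b)"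

definition initial :: "('a, 'h, 'v) block \<Rightarrow> bool" where
  "initial b \<longleftrightarrow> pointers b = {}"

definition points_to :: "('a, 'h, 'v) block \<Rightarrow> ('a, 'h, 'v) block \<Rightarrow> bool" where
  "points_to b b' \<longleftrightarrow> pointer_of b' \<in> pointers b"

definition collision_free :: "(('a, 'h) pointer set \<times> ('a, 'v) payload \<Rightarrow> 'h) \<Rightarrow> bool" where
  "collision_free hash \<longleftrightarrow> inj_on hash {(H, x). finite H}"

definition payloads_fun :: "('a set \<Rightarrow> ('a, 'v) payload set) \<Rightarrow> bool" where
  "payloads_fun X \<longleftrightarrow> mono X \<and> (\<forall>P. \<forall>q\<in>P. Follow q \<in> X P)"

definition self_edges :: "('a, 'h, 'v) block set \<Rightarrow> ('a, 'h, 'v) block rel" where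
  "self_edges B = {(b, b'). b' \<in> B \<and> points_to b b' \<and> creator b' = creator b}"

definition nonself_edges :: "('a, 'h, 'v) block set \<Rightarrow> ('a, 'h, 'v) block rel" where
  "nonself_edges B = {(b, b'). b' \<in> B \<and> points_to b b' \<and> creator b' \<noteq> creator b}"

text \<open>
  The source of an edge is not required to be in \<open>B\<close>: closure is also used for a block that is
  about to be added to \<open>B\<close>.
\<close>

definition closure :: "('a, 'h, 'v) block set \<Rightarrow> ('a, 'h, 'v) block \<Rightarrow> ('a, 'h, 'v) block set" where
  "closure B b = ((self_edges B)\<^sup>* O (nonself_edges B)\<^sup>= O (self_edges B)\<^sup>*) `` {b}"

text \<open>
  A block may carry several self-pointers, in which case the maximal path of self-pointers is not
  unique; every maximal path is then required to end in an initial block.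
\<close>

definition self_closed :: "('a, 'h, 'v) block set \<Rightarrow> ('a, 'h, 'v) block \<Rightarrow> bool" where
  "self_closed B b \<longleftrightarrow>
     (\<forall>e. (b, e) \<in> (self_edges B)\<^sup>* \<and> e \<notin> Domain (self_edges B) \<longrightarrow> initial e)"

definition closed_in :: "('a, 'h, 'v) block set \<Rightarrow> ('a, 'h, 'v) block \<Rightarrow> bool" where
  "closed_in B b \<longleftrightarrow> (\<forall>b'\<in>closure B b. self_closed B b')"

definition follows_in :: "('a, 'h, 'v) block set \<Rightarrow> 'a \<Rightarrow> 'a \<Rightarrow> bool" where
  "follows_in B p q \<longleftrightarrow> (\<exists>b\<in>B. creator b = p \<and> payload_of b = Follow q)"


section \<open>Cordial Dissemination\<close>

type_synonym ('a, 'h, 'v) msb =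
  "('a, 'h, 'v) block set \<times> ('a \<times> ('a, 'h, 'v) block) set"

datatype ('a, 'b) label =
    Create_Disclose
  | Send 'b 'a
  | Receive 'b
  | Cordially_Send 'b 'a

context
  fixes hash :: "('a, 'h) pointer set \<times> ('a, 'v) payload \<Rightarrow> 'h"
    and X :: "'a set \<Rightarrow> ('a, 'v) payload set"
begin

inductive is_block :: "'a set \<Rightarrow> ('a, 'h, 'v) block \<Rightarrow> bool" for P where
  is_block: "is_block P (Signed p (hash (H, x)), H, x)"
  if "p \<in> P" "x \<in> X P" "finite H" "\<forall>h\<in>H. \<exists>b'. is_block P b' \<and> pointer_of b' = h"

definition blocks :: "'a set \<Rightarrow> ('a, 'h, 'v) block set" where
  "blocks P = {b. is_block P b}"

definition observes ::
  "'a set \<Rightarrow> ('a, 'h, 'v) block \<Rightarrow> ('a, 'h, 'v) block \<Rightarrow> bool" where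
  "observes P b' b \<longleftrightarrow> (b', b) \<in> {(x, y). x \<in> blocks P \<and> y \<in> blocks P \<and> points_to x y}\<^sup>*"

definition maximally_closed ::
  "'a set \<Rightarrow> ('a, 'h, 'v) block set \<Rightarrow> ('a, 'h, 'v) block \<Rightarrow> bool" where
  "maximally_closed P B b \<longleftrightarrow>
     closed_in B b \<and>
     (\<forall>q\<in>P. follows_in B (creator b) q \<longrightarrow>
        (\<forall>b'\<in>B. creator b' = q \<and> self_closed B b' \<longrightarrow> observes P b b'))"

definition MSB :: "'a set \<Rightarrow> ('a, 'h, 'v) msb set" where
  "MSB P = {(B, Out). finite B \<and> B \<subseteq> blocks P \<and> finite Out \<and> Out \<subseteq> P \<times> blocks P}"

definition msb_order :: "('a, 'h, 'v) msb rel" where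
  "msb_order = {(s, s') \<in> MSB UNIV \<times> MSB UNIV. fst s \<subseteq> fst s' \<and> snd s \<subseteq> snd s'}"

text \<open>In the following notions of knowledge, \<open>B\<close> is the blocklace in the local state of the knower.\<close>

definition knows_block ::
  "'a set \<Rightarrow> ('a, 'h, 'v) block set \<Rightarrow> 'a \<Rightarrow> ('a, 'h, 'v) block \<Rightarrow> bool" where
  "knows_block P B q b \<longleftrightarrow> (\<exists>b'\<in>B. creator b' = q \<and> observes P b' b)"

definition knows_follows ::
  "'a set \<Rightarrow> ('a, 'h, 'v) block set \<Rightarrow> 'a \<Rightarrow> 'a \<Rightarrow> bool" where
  "knows_follows P B q p' \<longleftrightarrow>
     (\<exists>b'\<in>B. creator b' = q \<and> (\<exists>b\<in>blocks P. creator b = p' \<and> observes P b' b))"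

definition knows_friends ::
  "'a set \<Rightarrow> ('a, 'h, 'v) block set \<Rightarrow> 'a \<Rightarrow> 'a \<Rightarrow> bool" where
  "knows_friends P B p' q \<longleftrightarrow> knows_follows P B p' q \<and> knows_follows P B q p'"

fun rule ::
  "'a set \<Rightarrow> 'a \<Rightarrow> ('a, ('a, 'h, 'v) block) label \<Rightarrow>
   ('a, ('a, 'h, 'v) msb) config \<Rightarrow> ('a, ('a, 'h, 'v) msb) config \<Rightarrow> bool" where
  "rule P p Create_Disclose c c' \<longleftrightarrow>
     (\<exists>B Out b. c p = (B, Out) \<and> c' p = (B \<union> {b}, Out) \<and>
        b \<in> blocks P - B \<and> creator b = p \<and> maximally_closed P B b)"
| "rule P p (Send b q) c c' \<longleftrightarrow>
     (\<exists>B Out. c p = (B, Out) \<and> c' p = (B, Out \<union> {(q, b)}) \<and> b \<in> B)"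
| "rule P p (Receive b) c c' \<longleftrightarrow>
     (\<exists>B Out. c p = (B, Out) \<and> c' p = (B \<union> {b}, Out) \<and> b \<notin> B \<and>
        (\<exists>q\<in>P. \<exists>Bq Outq. c q = (Bq, Outq) \<and> (p, b) \<in> Outq))"
| "rule P p (Cordially_Send b q) c c' \<longleftrightarrow>
     (\<exists>B Out. c p = (B, Out) \<and> c' p = (B, Out \<union> {(q, b)}) \<and> b \<in> B \<and> (q, b) \<notin> Out \<and>
        knows_friends P B p q \<and> knows_follows P B q (creator b) \<and> \<not> knows_block P B q b)"

definition cd_transitions :: "'a set \<Rightarrow> ('a, ('a, 'h, 'v) msb) transition set" where
  "cd_transitions P =
     {(c, c'). \<exists>p\<in>P. p_transition P (MSB P) p c c' \<and> (\<exists>l. rule P p l c c')}"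

definition live_labels :: "'a set \<Rightarrow> ('a, ('a, 'h, 'v) block) label set" where
  "live_labels P =
     {Create_Disclose} \<union> {Cordially_Send b q | b q. b \<in> blocks P \<and> q \<in> P} \<union>
     {Receive b | b. b \<in> blocks P}"

text \<open>
  The liveness requirement partitions transitions by their label, so a transition has only one label
  there.  The rules alone leave one overlap: if \<open>p\<close> lacks a maximally-closed \<open>p\<close>-block \<open>b\<close> that is
  addressed to \<open>p\<close> in the output of some agent, then adding \<open>b\<close> is an instance of both
  Create&Disclose and Receive.  The label of such a transition is Create&Disclose.
  (With the overlapping sets the protocol would not be grassroots: if only agents in
  \<open>P' - P\<close> address \<open>b\<close> to \<open>p\<close>, the transition is a Receive over \<open>P'\<close>, but its projection to \<open>P\<close> is
  merely a Create&Disclose.)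
\<close>

definition has_label ::
  "'a set \<Rightarrow> 'a \<Rightarrow> ('a, ('a, 'h, 'v) block) label \<Rightarrow>
   ('a, ('a, 'h, 'v) msb) config \<Rightarrow> ('a, ('a, 'h, 'v) msb) config \<Rightarrow> bool" where
  "has_label P p l c c' \<longleftrightarrow>
     rule P p l c c' \<and> (l \<noteq> Create_Disclose \<longrightarrow> \<not> rule P p Create_Disclose c c')"

text \<open>The family is indexed by all labels, including those that no transition carries.\<close>

definition cd_liveness :: "'a set \<Rightarrow> ('a, ('a, 'h, 'v) msb) transition set set" where
  "cd_liveness P =
     {{(c, c'). p_transition P (MSB P) p c c' \<and> has_label P p l c c'} | p l.
        p \<in> P \<and> l \<in> live_labels P}"

definition CD :: "'a set \<Rightarrow> ('a, ('a, 'h, 'v) msb) transition_system" where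
  "CD P = \<lparr>agents = P, states = MSB P, correct = cd_transitions P, live = cd_liveness P\<rparr>"

end

text \<open>Cordial Dissemination is a protocol over the local states function \<open>MSB\<close>.\<close>

lemma is_block_mono:
  assumes "payloads_fun X" "P \<subseteq> P'" "is_block hash X P b"
  shows "is_block hash X P' b"
  using assms(3)
proof (induction rule: is_block.induct)
  case (is_block p x H)
  have "x \<in> X P'"
    using assms(1,2) is_block by (auto simp: payloads_fun_def dest: monoD)
  then show ?case
    using is_block assms(2) by (intro is_block.intros) blast+
qed

lemma blocks_mono:
  assumes "payloads_fun X" "P \<subseteq> P'"
  shows "blocks hash X P \<subseteq> blocks hash X P'"
  using is_block_mono[OF assms] by (auto simp: blocks_def)

lemma creator_in: "b \<in> blocks hash X P \<Longrightarrow> creator b \<in> P"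
  unfolding blocks_def mem_Collect_eq by (erule is_block.cases) (simp add: creator_def)

lemma follow_block:
  assumes "payloads_fun X" "p \<in> P"
  shows "(Signed p (hash ({}, Follow p)), {}, Follow p) \<in> blocks hash X P"
  using assms unfolding blocks_def mem_Collect_eq
  by (intro is_block.intros) (auto simp: payloads_fun_def)

lemma MSB_empty: "MSB hash X {} = {({}, {})}"
  using creator_in[of _ hash X "{}"] by (fastforce simp: MSB_def)

lemma MSB_strict_mono:
  assumes X: "payloads_fun X" and P: "P \<subset> P'"
  shows "MSB hash X P \<subset> MSB hash X P'"
proof -
  obtain q where q: "q \<in> P'" "q \<notin> P" using P by auto
  let ?b = "(Signed q (hash ({}, Follow q)), {}, Follow q)"
  have "?b \<in> blocks hash X P'" using follow_block[OF X q(1)] .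
  moreover have "?b \<notin> blocks hash X P" using creator_in[of ?b hash X P] q by (auto simp: creator_def)
  ultimately have "({?b}, {}) \<in> MSB hash X P' - MSB hash X P" by (auto simp: MSB_def)
  moreover have "MSB hash X P \<subseteq> MSB hash X P'"
    using blocks_mono[OF X psubset_imp_subset[OF P], where hash = hash] P
    unfolding MSB_def by fast
  ultimately show ?thesis by blast
qed

lemma MSB_local_states_fun:
  assumes "payloads_fun X"
  shows "local_states_fun (MSB hash X) ({}, {}) (msb_order hash X)"
  unfolding local_states_fun_def
proof (intro conjI allI impI)
  show "partial_order_on (MSB hash X UNIV) (msb_order hash X)"
    by (auto simp: partial_order_on_def preorder_on_def refl_on_def trans_def antisym_def msb_order_def)
  show "\<forall>s\<in>MSB hash X UNIV. (({}, {}), s) \<in> msb_order hash X"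
    by (auto simp: msb_order_def MSB_def)
qed (simp_all add: MSB_empty MSB_strict_mono[OF assms])

lemma CD_distributed_ts:
  fixes hash :: "('a, 'h) pointer set \<times> ('a, 'v) payload \<Rightarrow> 'h"
  assumes X: "payloads_fun X" and "P \<noteq> {}"
  shows "distributed_ts (CD hash X P)"
proof -
  define T where
    "T = (\<lambda>p. {(c, c'). p_transition P (MSB hash X P) p c c' \<and> (\<exists>l. rule hash X P p l c c')})"
  have "(\<forall>p\<in>P. T p \<subseteq> {(c, c'). p_transition P (MSB hash X P) p c c'}) \<and>
        cd_transitions hash X P = (\<Union>p\<in>P. T p)"
    by (auto simp: T_def cd_transitions_def)
  moreover have "cd_liveness hash X P \<subseteq> Pow (cd_transitions hash X P)"
    by (auto simp: cd_liveness_def cd_transitions_def has_label_def)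
  moreover have "cd_transitions hash X P \<notin> cd_liveness hash X P"
  proof
    assume "cd_transitions hash X P \<in> cd_liveness hash X P"
    then obtain p' l where l: "l \<in> live_labels hash X P" and
      eq: "cd_transitions hash X P =
        {(c, c'). p_transition P (MSB hash X P) p' c c' \<and> has_label hash X P p' l c c'}"
      by (auto simp: cd_liveness_def)
    obtain p where p: "p \<in> P" using assms(2) by auto
    define b where "b = (Signed p (hash ({}, Follow p)), {} :: ('a, 'h) pointer set, Follow p :: ('a, 'v) payload)"
    have b: "b \<in> blocks hash X P" unfolding b_def by (rule follow_block[OF X p])
    have cb: "creator b = p" by (simp add: b_def creator_def)
    define c where "c = restrict (\<lambda>q. if q = p then ({b}, {} :: ('a \<times> ('a, 'h, 'v) block) set) else ({}, {})) P"
    define c' where "c' = restrict (\<lambda>q. if q = p then ({b}, {(p, b)}) else ({}, {})) P"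
    have t: "p_transition P (MSB hash X P) p c c'"
      using p b by (auto simp: p_transition_def c_def c'_def MSB_def)
    have "rule hash X P p (Send b p) c c'" using p by (simp add: c_def c'_def)
    then have "(c, c') \<in> cd_transitions hash X P" using t p unfolding cd_transitions_def by blast
    then have lab: "p_transition P (MSB hash X P) p' c c'" "rule hash X P p' l c c'"
      unfolding eq has_label_def by auto
    have "p' = p"
      using lab(1) t by (auto simp: p_transition_def)
    moreover have "knows_block hash X P {b} p b"
      using cb by (auto simp: knows_block_def observes_def)
    ultimately show False using lab(2) l p
      by (auto simp: live_labels_def c_def c'_def)
  qed
  ultimately show ?thesis
    unfolding distributed_ts_def CD_def psubset_eq by (simp, blast)
qed

lemma CD_protocol:
  assumes "payloads_fun X"
  shows "protocol (MSB hash X) (CD hash X)"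
proof -
  have "agents (CD hash X P) = P \<and> states (CD hash X P) = MSB hash X P" for P
    by (simp add: CD_def)
  then show ?thesis
    using CD_distributed_ts[OF assms, of _ hash] by (simp add: protocol_def)
qed

end

theory Submission
  imports Defs
begin

text \<open>
  Collision-freeness makes \<open>blocks P\<close> closed under pointers inside \<open>blocks P'\<close>, so for local states
  over \<open>P\<close> observation, knowledge and maximal closure do not depend on whether they are evaluated
  over \<open>P\<close> or over \<open>P'\<close>.  Hence a transition over \<open>P\<close> lifts, with its label, to \<open>P'\<close> by putting the
  agents of \<open>P' - P\<close> in the initial state.  Conversely, a projected transition that is correct over
  \<open>P\<close> keeps its label; for Receive this uses the priority of Create&Disclose, since the sender
  might be outside \<open>P\<close>.  The sets of the remaining labels over \<open>P'\<close> contribute the empty set, which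
  is the set of a Cordially-Send of a block to its own creator.
\<close>

section \<open>Pointers determine blocks; lifting configurations\<close>

text \<open>A pointer holds the signer and the hash of the other two components; these lie in the
  domain of injectivity because \<open>H\<close> is finite.\<close>

lemma is_block_pointer_inject:
  assumes "collision_free hash" "is_block hash X P b" "is_block hash X P' b'"
    and "pointer_of b = pointer_of b'"
  shows "b = b'"
proof -
  obtain p H x where b: "b = (Signed p (hash (H, x)), H, x)" "finite H"
    using assms(2) by cases blast
  obtain p' H' x' where b': "b' = (Signed p' (hash (H', x')), H', x')" "finite H'"
    using assms(3) by cases blast
  have "(H, x) = (H', x')"
    using assms(1)[unfolded collision_free_def] b b' assms(4) by (auto dest: inj_onD)
  then show ?thesis using b b' assms(4) by simp
qed

lemma knows_block_creator: "b \<in> B \<Longrightarrow> knows_block hash X P B (creator b) b"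
  by (auto simp: knows_block_def observes_def)

text \<open>The value \<open>undefined\<close> outside \<open>P'\<close> keeps lifted configurations
  extensional.\<close>

definition extend_config ::
  "'a set \<Rightarrow> 'a set \<Rightarrow> ('a, ('a, 'h, 'v) msb) config \<Rightarrow> ('a, ('a, 'h, 'v) msb) config" where
  "extend_config P P' c = (\<lambda>q. if q \<in> P then c q else if q \<in> P' then ({}, {}) else undefined)"

lemma restrict_extend_config: "c \<in> P \<rightarrow>\<^sub>E A \<Longrightarrow> restrict (extend_config P P' c) P = c"
  by (auto simp: extend_config_def fun_eq_iff)

context
  fixes hash :: "('a, 'h) pointer set \<times> ('a, 'v) payload \<Rightarrow> 'h"
    and X :: "'a set \<Rightarrow> ('a, 'v) payload set"
    and P P' :: "'a set"
  assumes cf: "collision_free hash"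
    and X: "payloads_fun X"
    and sub: "P \<subseteq> P'"
begin

section \<open>Observation, knowledge and closure over \<open>P\<close> and over
  \<open>P'\<close>\<close>

lemma blocks_sub: "blocks hash X P \<subseteq> blocks hash X P'"
  by (rule blocks_mono[OF X sub])

lemma MSB_sub: "MSB hash X P \<subseteq> MSB hash X P'"
  using blocks_sub sub by (fastforce simp: MSB_def)

text \<open>A block over \<open>P\<close> has, for each of its pointers, some target over
  \<open>P\<close>; injectivity of pointers identifies that target with \<open>b'\<close>.\<close>

lemma points_to_blocks:
  assumes "b \<in> blocks hash X P" "b' \<in> blocks hash X P'" "points_to b b'"
  shows "b' \<in> blocks hash X P"
proof -
  have "is_block hash X P b" using assms(1) by (simp add: blocks_def)
  then obtain b'' where b'': "is_block hash X P b''" "pointer_of b'' = pointer_of b'"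
    using assms(3) by cases (auto simp: points_to_def)
  moreover have "is_block hash X P' b'" using assms(2) by (simp add: blocks_def)
  ultimately have "b'' = b'" using is_block_pointer_inject[OF cf] by blast
  then show ?thesis using b'' by (simp add: blocks_def)
qed

lemma observes_restrict:
  assumes "observes hash X P' b b'" "b \<in> blocks hash X P"
  shows "observes hash X P b b' \<and> b' \<in> blocks hash X P"
  using assms(1)[unfolded observes_def]
proof (induction rule: rtrancl_induct)
  case base
  then show ?case using assms(2) by (simp add: observes_def)
next
  case (step y z)
  then have "z \<in> blocks hash X P" using points_to_blocks by blast
  then show ?case using step by (auto simp: observes_def intro: rtrancl_into_rtrancl)
qed

lemma observes_extend: "observes hash X P b b' \<Longrightarrow> observes hash X P' b b'"
  unfolding observes_def by (erule rtrancl_mono[THEN subsetD, rotated]) (use blocks_sub in blast)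

lemma observes_iff:
  "b \<in> blocks hash X P \<Longrightarrow> observes hash X P' b b' \<longleftrightarrow> observes hash X P b b'"
  using observes_restrict observes_extend by blast

lemma knows_block_iff:
  "B \<subseteq> blocks hash X P \<Longrightarrow> knows_block hash X P' B q b \<longleftrightarrow> knows_block hash X P B q b"
  by (auto simp: knows_block_def observes_iff subset_iff)

lemma knows_follows_iff:
  assumes "B \<subseteq> blocks hash X P"
  shows "knows_follows hash X P' B q r \<longleftrightarrow> knows_follows hash X P B q r"
  using assms observes_restrict observes_extend blocks_sub
  unfolding knows_follows_def by (meson subsetD)

lemma knows_friends_iff:
  "B \<subseteq> blocks hash X P \<Longrightarrow> knows_friends hash X P' B q r \<longleftrightarrow> knows_friends hash X P B q r"
  by (simp add: knows_friends_def knows_follows_iff)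

text \<open>A followed agent outside \<open>P\<close> imposes no condition, since \<open>B\<close>
  has no block created by it.\<close>

lemma maximally_closed_iff:
  assumes "B \<subseteq> blocks hash X P" "b \<in> blocks hash X P"
  shows "maximally_closed hash X P' B b \<longleftrightarrow> maximally_closed hash X P B b"
proof -
  have "creator b' \<in> P" if "b' \<in> B" for b' using that assms(1) creator_in by blast
  then show ?thesis using assms sub by (auto simp: maximally_closed_def observes_iff)
qed

section \<open>Lifting rules and transitions\<close>

text \<open>Every rule but \<open>Receive\<close> reads only the local state of \<open>p\<close>, so
  agreement at \<open>p\<close> suffices; \<open>Receive\<close> also consults a sender, possibly in
  \<open>P' - P\<close>.\<close>

lemma rule_iff:
  assumes "d p = c p" "d' p = c' p" "c p \<in> MSB hash X P" "c' p \<in> MSB hash X P"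
    and "\<And>b. l \<noteq> Receive b"
  shows "rule hash X P' p l d d' \<longleftrightarrow> rule hash X P p l c c'"
proof -
  obtain B Out B' Out' where c: "c p = (B, Out)" "c' p = (B', Out')" by fastforce
  have B: "B \<subseteq> blocks hash X P" "B' \<subseteq> blocks hash X P" using assms(3,4) c by (auto simp: MSB_def)
  show ?thesis
  proof (cases l)
    case Create_Disclose
    have unfold: "rule hash X Q p Create_Disclose e e' \<longleftrightarrow>
        (\<exists>b. (B', Out') = (B \<union> {b}, Out) \<and>
          b \<in> blocks hash X Q - B \<and> creator b = p \<and> maximally_closed hash X Q B b)"
      if "e p = (B, Out)" "e' p = (B', Out')" for Q e e'
      using that by simp
    \<comment> \<open>The new block is in \<open>B'\<close>, hence over \<open>P\<close>, so letting
      \<open>b\<close> range over blocks of \<open>P'\<close> adds no witness.\<close>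
    have "(B', Out') = (B \<union> {b}, Out) \<and>
          b \<in> blocks hash X P' - B \<and> creator b = p \<and> maximally_closed hash X P' B b \<longleftrightarrow>
        (B', Out') = (B \<union> {b}, Out) \<and>
          b \<in> blocks hash X P - B \<and> creator b = p \<and> maximally_closed hash X P B b" for b
      using B blocks_sub maximally_closed_iff[OF B(1), of b] by blast
    then show ?thesis
      using unfold[of d d' P'] unfold[of c c' P] assms(1,2) c Create_Disclose by simp
  qed (use assms c B in \<open>auto simp: knows_friends_iff knows_follows_iff knows_block_iff\<close>)
qed

text \<open>Agreement on all of \<open>P\<close> is asked for because a \<open>Receive\<close> keeps
  its sender.\<close>

lemma rule_extend:
  assumes "\<And>q. q \<in> P \<Longrightarrow> d q = c q" "p \<in> P" "d' p = c' p"
    and "c p \<in> MSB hash X P" "c' p \<in> MSB hash X P" "rule hash X P p l c c'"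
  shows "rule hash X P' p l d d'"
proof (cases "\<exists>b. l = Receive b")
  case True
  then show ?thesis using assms sub by fastforce
next
  case False
  then show ?thesis using rule_iff[of d p c d' c' l] assms by blast
qed

lemma p_transition_extend:
  assumes "p_transition P (MSB hash X P) p c c'"
  shows "p_transition P' (MSB hash X P') p (extend_config P P' c) (extend_config P P' c')"
proof -
  have "({}, {}) \<in> MSB hash X P'" by (simp add: MSB_def)
  moreover have "c q \<in> MSB hash X P'" "c' q \<in> MSB hash X P'" if "q \<in> P" for q
    using assms that MSB_sub by (auto simp: p_transition_def)
  ultimately show ?thesis
    using assms sub by (auto simp: p_transition_def extend_config_def PiE_iff extensional_def)
qed

lemma p_transition_local_states:
  assumes "p_transition P (MSB hash X P) p c c'"
  shows "p \<in> P" "c p \<in> MSB hash X P" "c' p \<in> MSB hash X P" "c \<in> P \<rightarrow>\<^sub>E MSB hash X P"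
    "c' \<in> P \<rightarrow>\<^sub>E MSB hash X P"
  using assms by (auto simp: p_transition_def)

lemma proj_transitions_extendI:
  assumes "p_transition P (MSB hash X P) p c c'"
    and "(extend_config P P' c, extend_config P P' c') \<in> T"
  shows "(c, c') \<in> proj_transitions T P"
proof -
  have "c = restrict (extend_config P P' c) P" "c' = restrict (extend_config P P' c') P"
    by (simp_all only: restrict_extend_config[OF p_transition_local_states(4)[OF assms(1)]]
        restrict_extend_config[OF p_transition_local_states(5)[OF assms(1)]])
  then show ?thesis using assms(2) unfolding proj_transitions_def by blast
qed

lemma cd_transitions_sub_proj:
  "cd_transitions hash X P \<subseteq> proj_transitions (cd_transitions hash X P') P"
proof clarify
  fix c c' assume "(c, c') \<in> cd_transitions hash X P"
  then obtain p l where pl: "p_transition P (MSB hash X P) p c c'" "rule hash X P p l c c'"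
    by (auto simp: cd_transitions_def)
  let ?d = "extend_config P P' c" and ?d' = "extend_config P P' c'"
  have "rule hash X P' p l ?d ?d'"
    using p_transition_local_states[OF pl(1)] pl(2)
    by (intro rule_extend[where c = c and c' = c']) (auto simp: extend_config_def)
  then have "(?d, ?d') \<in> cd_transitions hash X P'"
    using p_transition_extend[OF pl(1)] p_transition_local_states(1)[OF pl(1)] sub
    by (auto simp: cd_transitions_def)
  then show "(c, c') \<in> proj_transitions (cd_transitions hash X P') P"
    using pl(1) proj_transitions_extendI by blast
qed

section \<open>Labels under lifting and projection\<close>

text \<open>A label includes the negative condition of not being a \<open>Create_Disclose\<close>;
  this transfers because \<open>rule_iff\<close> is an equivalence for that rule.\<close>

lemma has_label_extend:
  assumes t: "p_transition P (MSB hash X P) p c c'" and "has_label hash X P p l c c'"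
  shows "has_label hash X P' p l (extend_config P P' c) (extend_config P P' c')"
proof -
  note m = p_transition_local_states[OF t]
  have eq: "extend_config P P' c q = c q" "extend_config P P' c' q = c' q" if "q \<in> P" for q
    using that by (auto simp: extend_config_def)
  show ?thesis
    using assms(2) m eq rule_extend[of "extend_config P P' c" c p "extend_config P P' c'" c' l]
      rule_iff[of "extend_config P P' c" p c "extend_config P P' c'" c' Create_Disclose]
    by (auto simp: has_label_def simp del: rule.simps)
qed

lemma has_label_restrict:
  assumes t: "(restrict d P, restrict d' P) \<in> cd_transitions hash X P"
    and "p \<in> P" "d p \<noteq> d' p" and lab: "has_label hash X P' p l d d'"
  shows "p_transition P (MSB hash X P) p (restrict d P) (restrict d' P)"
    and "has_label hash X P p l (restrict d P) (restrict d' P)"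
    and "l \<in> live_labels hash X P' \<Longrightarrow> l \<in> live_labels hash X P"
proof -
  let ?c = "restrict d P" and ?c' = "restrict d' P"
  obtain p0 l0 where pl: "p_transition P (MSB hash X P) p0 ?c ?c'" "rule hash X P p0 l0 ?c ?c'"
    using t by (auto simp: cd_transitions_def)
  \<comment> \<open>Only one agent changes state in a transition, and \<open>p\<close> does.\<close>
  have p0: "p0 = p" using pl(1) assms(2,3) by (auto simp: p_transition_def)
  show tr: "p_transition P (MSB hash X P) p ?c ?c'" using pl(1) p0 by simp
  note m = p_transition_local_states[OF tr]
  have eq: "d p = ?c p" "d' p = ?c' p" using assms(2) by simp_all
  note iff = rule_iff[of d p ?c d' ?c', OF eq m(2,3)]
  have "rule hash X P p l ?c ?c'"
  proof (cases "\<exists>b. l = Receive b")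
    case True
    then obtain b where b: "l = Receive b" by blast
    \<comment> \<open>Correctness over \<open>P\<close> supplies a rule \<open>l0\<close>. Priority
      excludes \<open>Create_Disclose\<close>, and the growth of the blocklace excludes both sends;
      what remains is a \<open>Receive\<close> of the same block, with a sender in
      \<open>P\<close>.\<close>
    have "\<not> rule hash X P' p Create_Disclose d d'" using lab b by (simp add: has_label_def)
    then have "l0 \<noteq> Create_Disclose" using pl(2) p0 iff[of Create_Disclose] by (auto simp del: rule.simps)
    moreover obtain B Out where B: "d p = (B, Out)" "d' p = (B \<union> {b}, Out)" "b \<notin> B"
      using lab b by (auto simp: has_label_def)
    ultimately have "l0 = Receive b"
      using pl(2) p0 assms(2) by (cases l0) auto
    then show ?thesis using pl(2) p0 b by simp
  next
    case False
    then show ?thesis using iff[of l] lab by (auto simp: has_label_def simp del: rule.simps)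
  qed
  then show "has_label hash X P p l ?c ?c'"
    using lab iff[of Create_Disclose] by (auto simp: has_label_def simp del: rule.simps)
  \<comment> \<open>The block and any destination named by \<open>l\<close> occur in
    \<open>?c' p\<close>, a local state over \<open>P\<close>.\<close>
  show "l \<in> live_labels hash X P" if "l \<in> live_labels hash X P'"
    using that m(3) \<open>rule hash X P p l ?c ?c'\<close>
    by (cases l) (auto simp: live_labels_def MSB_def)
qed

section \<open>Projection of the liveness requirement\<close>

abbreviation labelled ::
  "'a set \<Rightarrow> 'a \<Rightarrow> ('a, ('a, 'h, 'v) block) label \<Rightarrow> ('a, ('a, 'h, 'v) msb) transition set" where
  "labelled Q p l \<equiv>
     {(c, c'). p_transition Q (MSB hash X Q) p c c' \<and> has_label hash X Q p l c c'}"

text \<open>The intersection discards projected steps that are not correct over \<open>P\<close>,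
  such as a \<open>Receive\<close> with all its senders outside \<open>P\<close>.\<close>

lemma proj_labelled:
  assumes "p \<in> P"
  shows "proj_transitions (labelled P' p l) P \<inter> cd_transitions hash X P = labelled P p l"
proof (intro equalityI subsetI)
  fix t assume "t \<in> proj_transitions (labelled P' p l) P \<inter> cd_transitions hash X P"
  then obtain d d' where d: "t = (restrict d P, restrict d' P)" "d p \<noteq> d' p"
    "has_label hash X P' p l d d'" "(restrict d P, restrict d' P) \<in> cd_transitions hash X P"
    by (auto simp: proj_transitions_def p_transition_def)
  then show "t \<in> labelled P p l" using has_label_restrict(1,2)[OF d(4) assms d(2,3)] by simp
next
  fix t assume "t \<in> labelled P p l"
  then obtain c c' where c: "t = (c, c')" "p_transition P (MSB hash X P) p c c'"
    "has_label hash X P p l c c'"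
    by auto
  then have "t \<in> cd_transitions hash X P"
    using assms by (auto simp: cd_transitions_def has_label_def)
  then show "t \<in> proj_transitions (labelled P' p l) P \<inter> cd_transitions hash X P"
    using proj_transitions_extendI[OF c(2)] p_transition_extend[OF c(2)]
      has_label_extend[OF c(2,3)] c(1) by simp
qed

text \<open>A step of an agent outside \<open>P\<close> projects to a stutter, which is never
  correct; for an agent in \<open>P\<close>, a surviving step would make its label live over
  \<open>P\<close>.\<close>

lemma proj_labelled_empty:
  assumes "p \<notin> P \<or> l \<notin> live_labels hash X P" "l \<in> live_labels hash X P'"
  shows "proj_transitions (labelled P' p l) P \<inter> cd_transitions hash X P = {}"
proof (rule ccontr)
  assume "\<not> ?thesis"
  then obtain d d' where d: "p_transition P' (MSB hash X P') p d d'"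
    "has_label hash X P' p l d d'" "(restrict d P, restrict d' P) \<in> cd_transitions hash X P"
    by (auto simp: proj_transitions_def)
  show False
  proof (cases "p \<in> P")
    case True
    then show False
      using has_label_restrict(3)[OF d(3) True _ d(2)] d(1) assms by (auto simp: p_transition_def)
  next
    case False
    then have "restrict d P = restrict d' P"
      using d(1) sub by (auto simp: p_transition_def restrict_def fun_eq_iff)
    then show False using d(3) by (auto simp: cd_transitions_def p_transition_def)
  qed
qed

lemma empty_in_cd_liveness:
  assumes "p \<in> P"
  shows "{} \<in> cd_liveness hash X P"
proof -
  \<comment> \<open>\<open>payloads_fun\<close> guarantees this payload, so the block exists over
    \<open>P\<close>. Whoever holds it knows that its creator knows it, which blocks the send to
    \<open>p\<close>.\<close>
  let ?b = "(Signed p (hash ({}, Follow p)), {}, Follow p) :: ('a, 'h, 'v) block"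
  have "creator ?b = p" by (simp add: creator_def)
  then have "labelled P p (Cordially_Send ?b p) = {}"
    using knows_block_creator[of ?b _ hash X P] by (auto simp: has_label_def)
  moreover have "Cordially_Send ?b p \<in> live_labels hash X P"
    using follow_block[OF X assms] assms by (auto simp: live_labels_def)
  ultimately show ?thesis using assms unfolding cd_liveness_def by blast
qed

text \<open>Nonemptiness of \<open>P\<close> provides the agent whose label yields the empty
  set.\<close>

lemma cd_liveness_proj:
  assumes "P \<noteq> {}"
  shows "cd_liveness hash X P =
    {proj_transitions L P \<inter> cd_transitions hash X P | L. L \<in> cd_liveness hash X P'}"
proof (intro equalityI subsetI)
  fix K assume "K \<in> cd_liveness hash X P"
  then obtain p l where pl: "p \<in> P" "l \<in> live_labels hash X P" "K = labelled P p l"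
    by (auto simp: cd_liveness_def)
  have "l \<in> live_labels hash X P'" using pl(2) sub blocks_sub by (auto simp: live_labels_def)
  then have "labelled P' p l \<in> cd_liveness hash X P'"
    using pl(1) sub unfolding cd_liveness_def by blast
  then show "K \<in> {proj_transitions L P \<inter> cd_transitions hash X P | L. L \<in> cd_liveness hash X P'}"
    using proj_labelled[OF pl(1), of l] pl(3) by blast
next
  fix K
  assume "K \<in> {proj_transitions L P \<inter> cd_transitions hash X P | L. L \<in> cd_liveness hash X P'}"
  then obtain p l where pl: "l \<in> live_labels hash X P'"
    "K = proj_transitions (labelled P' p l) P \<inter> cd_transitions hash X P"
    unfolding cd_liveness_def by blast
  show "K \<in> cd_liveness hash X P"
  proof (cases "p \<in> P \<and> l \<in> live_labels hash X P")
    case True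
    then show ?thesis using proj_labelled[of p l] pl(2) unfolding cd_liveness_def by blast
  next
    case False
    then have "K = {}" using proj_labelled_empty[of p l] pl by blast
    then show ?thesis using empty_in_cd_liveness assms by blast
  qed
qed

end

theorem proposition29:
  fixes hash :: "('a, 'h) pointer set \<times> ('a, 'v) payload \<Rightarrow> 'h"
    and X :: "'a set \<Rightarrow> ('a, 'v) payload set"
  assumes "collision_free hash"
    and "payloads_fun X"
  shows "grassroots (CD hash X)"
  unfolding grassroots_def
proof (intro allI impI)
  fix P P' :: "'a set"
  assume P: "finite P' \<and> {} \<subset> P \<and> P \<subset> P'"
  then have sub: "P \<subseteq> P'" and ne: "P \<noteq> {}" by auto
  have strict: "MSB hash X P \<subset> MSB hash X P'" by (rule MSB_strict_mono[OF assms(2)]) (use P in blast)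
  have "ts_subset (CD hash X P) (proj_ts (CD hash X P') P)"
    using strict cd_transitions_sub_proj[OF assms sub] cd_liveness_proj[OF assms sub ne]
    unfolding ts_subset_def proj_ts_def CD_def by simp blast
  \<comment> \<open>Projection keeps the local states of \<open>P'\<close>, so the two systems
    already differ in their states.\<close>
  moreover have "CD hash X P \<noteq> proj_ts (CD hash X P') P"
    using strict by (auto simp: CD_def proj_ts_def)
  ultimately show "ts_psubset (CD hash X P) (proj_ts (CD hash X P') P)"
    by (simp add: ts_psubset_def)
qed

end
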